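(* Let $\mathcal S$ be nested as in the context, and let $p\in I$ and $S'\subsetneq J$ be such that $|S'\cup S_{p-1}|\le n-l<|S'\cup S_p|$. Then the following conditions are necessary for the inequality $$\sum_{j\in S'}z_j\ \ge\ \bigl(|S'\cup S_p|-n+l\bigr)\delta_p+\sum_{i=p+1}^m\bigl(|S'\cup S_i|-|S'\cup S_{i-1}|\bigr)\delta_i$$ to define a facet of $\operatorname{conv}(X^{l,u})$: (L1) $S'\cap S_p=\emptyset$; (L2) $|S'|\le n-l-1$.
   Context: Let $n,m$ be positive integers, $J=\{1,\dots,n\}$, $I=\{1,\dots,m\}$, and let $l,u$ be integers with $0\le l<u$ and $u\ge2$. The sets are nested: $S_1\subsetneq S_2\subsetneq\dots\subsetneq S_m\subsetneq J$, with $|S_1|\ge 2$ and $l\le n-|S_m|$; $\mathcal S=\{S_i\}_{i\in I}$. Put $S_0=\emptyset$. Define $$X^{l,u}=\Bigl\{(z,\delta)\in\{0,1\}^n\times\{0,1\}^m:\ \delta_i=\prod_{j\in S_i}(1-z_j)\ (i\in I),\ l\le\sum_{j\in J}z_j\le u\Bigr\}.$$ *)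

theory Defs
  imports "HOL-Analysis.Analysis"
begin

(* J is the whole index type 'n, so n = CARD('n) and z is a vector of type real^'n.  The index
   set {1..m} of the nested sets stays a set of naturals, so that i - 1 and sums from p + 1 to m
   can be written as usual; e is any enumeration of the m = CARD('m) coordinates of delta by
   {1..m}, and delta_i is d $ e i. *)

definition Xlu ::
  "(nat \<Rightarrow> 'm::finite) \<Rightarrow> (nat \<Rightarrow> 'n::finite set) \<Rightarrow> int \<Rightarrow> int \<Rightarrow> ((real^'n) \<times> (real^'m)) set"
where
  "Xlu e S l u =
     {(z, d). (\<forall>j. z $ j \<in> {0, 1}) \<and> (\<forall>k. d $ k \<in> {0, 1}) \<and>
        (\<forall>i\<in>{1..CARD('m)}. d $ e i = (\<Prod>j\<in>S i. 1 - z $ j)) \<and>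
        of_int l \<le> (\<Sum>j\<in>UNIV. z $ j) \<and> (\<Sum>j\<in>UNIV. z $ j) \<le> of_int u}"

definition ineq_lhs :: "'n::finite set \<Rightarrow> (real^'n) \<times> (real^'m::finite) \<Rightarrow> real" where
  "ineq_lhs S' = (\<lambda>(z, d). \<Sum>j\<in>S'. z $ j)"

definition ineq_rhs ::
  "(nat \<Rightarrow> 'm::finite) \<Rightarrow> (nat \<Rightarrow> 'n::finite set) \<Rightarrow> int \<Rightarrow> 'n set \<Rightarrow> nat
     \<Rightarrow> (real^'n) \<times> (real^'m) \<Rightarrow> real"
where
  "ineq_rhs e S l S' p = (\<lambda>(z, d).
     (real (card (S' \<union> S p)) - real CARD('n) + of_int l) * d $ e p +
     (\<Sum>i = p + 1..CARD('m).
        (real (card (S' \<union> S i)) - real (card (S' \<union> S (i - 1)))) * d $ e i))"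

(* The inequality f x >= g x (f, g affine) is valid on the polytope P and the face of P on
   which it is tight is a facet. *)
definition defines_facet ::
  "('a::euclidean_space \<Rightarrow> real) \<Rightarrow> ('a \<Rightarrow> real) \<Rightarrow> 'a set \<Rightarrow> bool"
where
  "defines_facet f g P \<longleftrightarrow>
     (\<forall>x\<in>P. f x \<ge> g x) \<and> {x \<in> P. f x = g x} facet_of P"

end

theory Submission imports Defs begin

text \<open>
  A facet cannot lie properly inside another proper face. Hence, if an affine function \<open>h\<close> with
  \<open>0 \<le> h \<le> f - g\<close> on a polytope does not vanish identically there, and \<open>f \<ge> g\<close> defines a facet,
  then the facet lies in the face \<open>h = 0\<close> and so equals it: every point with \<open>h = 0\<close> must satisfy
  \<open>f = g\<close> (lemma \<open>facet_tight_where_dominated_tight\<close>). By linearity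
  the bounds on \<open>h\<close> have to be verified only at the points whose hull is taken, here the vectors
  determined by the sets \<open>K\<close> with \<open>l \<le> |K| \<le> u\<close> (lemma \<open>Xlu_eq_image\<close>).

  At such a point the right-hand side telescopes: it is \<open>0\<close> if \<open>K\<close> meets \<open>S p\<close>, and otherwise
  \<open>|S' \<union> S t| - n + l\<close> for the largest \<open>t\<close> with \<open>K\<close> and \<open>S t\<close> disjoint. In the latter case
  \<open>K - S'\<close> lies outside \<open>S' \<union> S t\<close>, so that
  \<open>|K \<inter> S'| - rhs \<ge> |K| - l\<close> (lemma \<open>ineq_rhs_indicator_point_le\<close>).

  If there is a \<open>j\<close> in \<open>S' \<inter> S p\<close>, take \<open>h = z\<^sub>j\<close>: it is at most the slack, because a \<open>K\<close> containing
  \<open>j\<close> meets \<open>S p\<close> and \<open>S'\<close>, which makes the slack \<open>|K \<inter> S'| \<ge> 1\<close>;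
  for any other \<open>K\<close> the inequality being valid suffices. If \<open>|S'| \<ge> n - l\<close>, take
  \<open>h = (\<Sum>j. z\<^sub>j) - l\<close>: now \<open>|K - S'| \<le> l\<close>, and the slack is at least \<open>|K| - l\<close> also when \<open>K\<close>
  meets \<open>S p\<close>. In both cases the contradiction comes from a \<open>K\<close> with \<open>h = 0\<close> that meets both \<open>S p\<close>
  and \<open>S'\<close>: its slack is positive. For the first \<open>h\<close> such a \<open>K\<close> exists because \<open>S p\<close> has an element
  other than \<open>j\<close> and \<open>S'\<close> has an element outside \<open>S p\<close>; for the second because
  \<open>2 \<le> |S p| \<le> n - |S'| \<le> l\<close>, once \<open>S'\<close> and \<open>S p\<close> are known to be disjoint.
\<close>

section \<open>Facets and dominated affine functions\<close>

text \<open>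
  The set where \<open>a \<bullet> x = c\<close> is a face that contains the facet \<open>f = g\<close>, by the two bounds. It is
  proper because of \<open>x\<close>, so its dimension leaves no room for strict inclusion.
\<close>

lemma facet_tight_where_dominated_tight:
  fixes X :: "'a::euclidean_space set"
  assumes facet: "defines_facet f g (convex hull X)"
    and f: "linear f" and g: "linear g"
    and nonneg: "\<And>x. x \<in> X \<Longrightarrow> c \<le> a \<bullet> x"
    and dominated: "\<And>x. x \<in> X \<Longrightarrow> a \<bullet> x - c \<le> f x - g x"
    and x: "x \<in> X" "a \<bullet> x > c"
    and y: "y \<in> X" "a \<bullet> y = c"
  shows "f y = g y"
proof -
  define P where "P = convex hull X"
  define F where "F = {x \<in> P. f x = g x}"
  define G where "G = P \<inter> {x. a \<bullet> x = c}"
  have F: "F facet_of P"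
    using facet by (simp add: defines_facet_def F_def P_def)
  have XP: "X \<subseteq> P" by (simp add: P_def hull_subset)
  have nonneg_P: "c \<le> a \<bullet> v" if "v \<in> P" for v
  proof -
    have "P \<subseteq> {v. a \<bullet> v \<ge> c}" unfolding P_def
      by (rule hull_minimal) (auto simp: nonneg convex_halfspace_ge)
    with that show ?thesis by auto
  qed
  have dominated_P: "a \<bullet> v - c \<le> f v - g v" if "v \<in> P" for v
  proof -
    have lin: "linear (\<lambda>v. a \<bullet> v - (f v - g v))"
      by (intro linear_compose_sub f g bounded_linear.linear[OF bounded_linear_inner_right])
    have "{v. a \<bullet> v - c \<le> f v - g v} = (\<lambda>v. a \<bullet> v - (f v - g v)) -` {..c}" by auto
    then have "convex {v. a \<bullet> v - c \<le> f v - g v}"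
      using convex_linear_vimage[OF lin, of "{..c}"] by simp
    then have "P \<subseteq> {v. a \<bullet> v - c \<le> f v - g v}" unfolding P_def
      by (intro hull_minimal) (auto simp: dominated)
    with that show ?thesis by auto
  qed
  have convex: "convex P" by (simp add: P_def)
  have G: "G face_of P" unfolding G_def
    using convex nonneg_P by (intro face_of_Int_supporting_hyperplane_ge) auto
  have "F \<subseteq> G"
    using nonneg_P dominated_P by (force simp: F_def G_def)
  with F have FG: "F face_of G"
    by (metis face_of_subset facet_of_imp_face_of G face_of_imp_subset)
  have "G \<noteq> P" using x XP by (auto simp: G_def)
  then have "aff_dim G < aff_dim P" using face_of_aff_dim_lt[OF convex G] by simp
  moreover have "aff_dim F = aff_dim P - 1" using F by (simp add: facet_of_def)
  moreover have "aff_dim F < aff_dim G" if "F \<noteq> G"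
    using face_of_aff_dim_lt[OF _ FG that] face_of_imp_convex[OF G] by simp
  ultimately have "F = G" by force
  moreover have "y \<in> G" using y XP by (auto simp: G_def)
  ultimately show ?thesis by (auto simp: F_def)
qed

lemma linear_ineq_lhs: "linear (ineq_lhs S')"
  by (rule linearI)
    (auto simp: ineq_lhs_def case_prod_beta sum.distrib sum_distrib_left)

lemma linear_ineq_rhs: "linear (ineq_rhs e S l S' p)"
  by (rule linearI)
    (auto simp: ineq_rhs_def case_prod_beta sum.distrib sum_distrib_left distrib_left mult.left_commute)

section \<open>The points as indicator vectors of sets\<close>

definition indicator_point ::
  "(nat \<Rightarrow> 'm::finite) \<Rightarrow> (nat \<Rightarrow> 'n::finite set) \<Rightarrow> 'n set \<Rightarrow> (real^'n) \<times> (real^'m)"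
where
  "indicator_point e S K =
     ((\<chi> j. of_bool (j \<in> K)),
      (\<chi> k. of_bool (K \<inter> S (inv_into {1..CARD('m)} e k) = {})))"

lemma prod_one_minus_of_bool:
  assumes "finite A"
  shows "(\<Prod>j\<in>A. 1 - of_bool (j \<in> K)) = (of_bool (K \<inter> A = {}) :: real)"
  using assms by (induction A rule: finite_induct) auto

lemma Xlu_eq_image:
  fixes e :: "nat \<Rightarrow> 'm::finite" and S :: "nat \<Rightarrow> 'n::finite set"
  assumes enum: "bij_betw e {1..CARD('m)} (UNIV :: 'm set)"
  shows "Xlu e S l u = indicator_point e S ` {K. l \<le> int (card K) \<and> int (card K) \<le> u}"
proof (intro equalityI subsetI)
  fix x assume "x \<in> Xlu e S l u"
  then obtain z d where x: "x = (z, d)" and z: "\<And>j. z $ j \<in> {0, 1}"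
    and d: "\<And>i. i \<in> {1..CARD('m)} \<Longrightarrow> d $ e i = (\<Prod>j\<in>S i. 1 - z $ j)"
    and sum: "of_int l \<le> (\<Sum>j\<in>UNIV. z $ j)" "(\<Sum>j\<in>UNIV. z $ j) \<le> of_int u"
    by (auto simp: Xlu_def)
  define K where "K = {j. z $ j = 1}"
  have z_eq: "z $ j = of_bool (j \<in> K)" for j using z[of j] by (auto simp: K_def)
  have "(\<Sum>j\<in>UNIV. z $ j) = real (card K)" by (simp add: z_eq)
  with sum have "l \<le> int (card K)" "int (card K) \<le> u" by linarith+
  moreover have "d $ k = of_bool (K \<inter> S (inv_into {1..CARD('m)} e k) = {})" for k
    using d[of "inv_into {1..CARD('m)} e k"] enum
    by (simp add: z_eq prod_one_minus_of_bool bij_betw_def inv_into_into f_inv_into_f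
        del: atLeastAtMost_iff)
  ultimately show "x \<in> indicator_point e S ` {K. l \<le> int (card K) \<and> int (card K) \<le> u}"
    by (intro image_eqI[of _ _ K]) (auto simp: x indicator_point_def vec_eq_iff z_eq)
next
  fix x assume "x \<in> indicator_point e S ` {K. l \<le> int (card K) \<and> int (card K) \<le> u}"
  then show "x \<in> Xlu e S l u"
    using bij_betw_imp_inj_on[OF enum]
    by (auto simp: Xlu_def indicator_point_def prod_one_minus_of_bool sum.If_cases)
qed

lemma ineq_lhs_indicator_point:
  "ineq_lhs S' (indicator_point e S K) = real (card (K \<inter> S'))"
  by (simp add: ineq_lhs_def indicator_point_def sum.If_cases Int_commute)

section \<open>The right-hand side of the inequality\<close>

lemma chain_mono:
  fixes S :: "nat \<Rightarrow> 'a set"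
  assumes "\<forall>i. 1 \<le> i \<and> i < m \<longrightarrow> S i \<subset> S (i + 1)" "1 \<le> i" "i \<le> k" "k \<le> m"
  shows "S i \<subseteq> S k"
  using assms(3,4)
proof (induction k rule: dec_induct)
  case (step k)
  with assms(1,2) show ?case by (metis Suc_eq_plus1 Suc_leD Suc_le_lessD le_trans
        subset_trans psubset_imp_subset)
qed simp

lemma ineq_rhs_indicator_point_meets:
  fixes e :: "nat \<Rightarrow> 'm::finite" and S :: "nat \<Rightarrow> 'n::finite set"
  assumes enum: "bij_betw e {1..CARD('m)} (UNIV :: 'm set)"
    and nested: "\<forall>i. 1 \<le> i \<and> i < CARD('m) \<longrightarrow> S i \<subset> S (i + 1)"
    and p: "p \<in> {1..CARD('m)}" and meets: "K \<inter> S p \<noteq> {}"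
  shows "ineq_rhs e S l S' p (indicator_point e S K) = 0"
proof -
  have "K \<inter> S i \<noteq> {}" if "p \<le> i" "i \<le> CARD('m)" for i
    using chain_mono[OF nested, of p i] that p meets by auto
  then show ?thesis using p bij_betw_imp_inj_on[OF enum]
    by (auto simp: ineq_rhs_def indicator_point_def intro!: sum.neutral)
qed

text \<open>
  With \<open>t\<close> the last index for which \<open>K\<close> and \<open>S t\<close> are disjoint, the right-hand side telescopes to
  \<open>|S' \<union> S t| - n + l\<close>, while \<open>K - S'\<close> lies in the complement of \<open>S' \<union> S t\<close>.
\<close>

lemma ineq_rhs_indicator_point_le:
  fixes e :: "nat \<Rightarrow> 'm::finite" and S :: "nat \<Rightarrow> 'n::finite set"
  assumes enum: "bij_betw e {1..CARD('m)} (UNIV :: 'm set)"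
    and nested: "\<forall>i. 1 \<le> i \<and> i < CARD('m) \<longrightarrow> S i \<subset> S (i + 1)"
    and p: "p \<in> {1..CARD('m)}" and disjoint: "K \<inter> S p = {}"
  shows "real (card K) - of_int l \<le>
    real (card (K \<inter> S')) - ineq_rhs e S l S' p (indicator_point e S K)"
proof -
  define T where "T = {i \<in> {p..CARD('m)}. K \<inter> S i = {}}"
  define t where "t = Max T"
  define c where "c i = real (card (S' \<union> S i))" for i
  have T: "finite T" "p \<in> T" using p disjoint by (auto simp: T_def)
  then have "t \<in> T" unfolding t_def by (intro Max_in) auto
  then have t: "p \<le> t" "t \<le> CARD('m)" "K \<inter> S t = {}" by (auto simp: T_def)
  have disjoint_iff: "K \<inter> S i = {} \<longleftrightarrow> i \<le> t" if "p \<le> i" "i \<le> CARD('m)" for i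
  proof
    assume "K \<inter> S i = {}"
    then show "i \<le> t" unfolding t_def using T that by (intro Max_ge) (auto simp: T_def)
  next
    assume "i \<le> t"
    then show "K \<inter> S i = {}" using chain_mono[OF nested, of i t] t that p by auto
  qed
  have delta: "snd (indicator_point e S K) $ e i = of_bool (i \<le> t)"
    if "p \<le> i" "i \<le> CARD('m)" for i
    using disjoint_iff[OF that] that p bij_betw_imp_inj_on[OF enum]
    by (simp add: indicator_point_def)
  have "(\<Sum>i = p + 1..CARD('m). (c i - c (i - 1)) * snd (indicator_point e S K) $ e i) =
    (\<Sum>i = p + 1..CARD('m). (c i - c (i - 1)) * of_bool (i \<le> t))"
    by (intro sum.cong refl) (simp add: delta)
  also have "\<dots> = (\<Sum>i = Suc p..t. c i - c (i - 1))"
    using t by (intro sum.mono_neutral_cong_right) auto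
  also have "\<dots> = c t - c p"
    by (rule sum_telescope''[OF t(1)])
  finally have "ineq_rhs e S l S' p (indicator_point e S K) = c t - real CARD('n) + of_int l"
    using p delta[of p] t by (simp add: ineq_rhs_def case_prod_beta c_def)
  moreover have "card (K - S') + card (S' \<union> S t) \<le> CARD('n)"
    using t by (subst card_Un_disjoint[symmetric]) (auto intro: card_mono)
  moreover have "card K = card (K \<inter> S') + card (K - S')"
    by (metis card_Int_Diff finite)
  ultimately show ?thesis by (simp add: c_def)
qed

section \<open>Necessary conditions for a facet\<close>

theorem theorem17:
  fixes S :: "nat \<Rightarrow> 'n::finite set" and e :: "nat \<Rightarrow> 'm::finite"
    and l u :: int and p :: nat and S' :: "'n set"
  assumes enum: "bij_betw e {1..CARD('m)} (UNIV :: 'm set)"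
    and lu: "0 \<le> l" "l < u" "2 \<le> u"
    and S0: "S 0 = {}"
    and nested: "\<forall>i. 1 \<le> i \<and> i < CARD('m) \<longrightarrow> S i \<subset> S (i + 1)"
    and proper: "S CARD('m) \<subset> UNIV"
    and S1: "card (S 1) \<ge> 2"
    and l_le: "l \<le> int CARD('n) - int (card (S CARD('m)))"
    and p: "p \<in> {1..CARD('m)}"
    and S': "S' \<subset> UNIV"
    and p_lower: "int (card (S' \<union> S (p - 1))) \<le> int CARD('n) - l"
    and p_upper: "int CARD('n) - l < int (card (S' \<union> S p))"
    and facet: "defines_facet (ineq_lhs S') (ineq_rhs e S l S' p) (convex hull (Xlu e S l u))"
  shows "S' \<inter> S p = {} \<and> int (card S') \<le> int CARD('n) - l - 1"
proof -
  note rhs_meets = ineq_rhs_indicator_point_meets[OF enum nested p]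
  note rhs_le = ineq_rhs_indicator_point_le[OF enum nested p]
  have Sp_ge: "2 \<le> card (S p)"
    using card_mono[OF finite chain_mono[OF nested, of 1 p]] p S1 by auto
  have Sp_le: "card (S p) \<le> card (S CARD('m))"
    using card_mono[OF finite chain_mono[OF nested, of p "CARD('m)"]] p by auto
  have "card (S CARD('m)) < CARD('n)"
    using proper by (intro psubset_card_mono) auto
  with Sp_ge Sp_le l_le have n: "3 \<le> CARD('n)" "l + 2 \<le> int CARD('n)" by linarith+
  obtain s where s: "s \<in> S'" "s \<notin> S p"
  proof -
    have "\<not> S' \<subseteq> S p"
    proof
      assume "S' \<subseteq> S p"
      then have "S' \<union> S p = S p" by auto
      with p_upper Sp_le l_le show False by simp
    qed
    with that show thesis by auto
  qed
  \<comment> \<open>The common core of both parts: \<open>L\<close> shows that \<open>h = a \<bullet> x - c\<close> is not identically \<open>0\<close>, so \<open>K\<close>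
    is tight; as \<open>K\<close> meets \<open>S p\<close>, the right-hand side vanishes there.\<close>
  have tight: "K \<inter> S' = {}"
    if size: "l \<le> int (card K)" "int (card K) \<le> u" and meets: "K \<inter> S p \<noteq> {}"
      and nonneg: "\<And>K. \<lbrakk>l \<le> int (card K); int (card K) \<le> u\<rbrakk> \<Longrightarrow>
        c \<le> a \<bullet> indicator_point e S K"
      and dominated: "\<And>K. \<lbrakk>l \<le> int (card K); int (card K) \<le> u\<rbrakk> \<Longrightarrow>
        a \<bullet> indicator_point e S K - c \<le>
          real (card (K \<inter> S')) - ineq_rhs e S l S' p (indicator_point e S K)"
      and L: "l \<le> int (card L)" "int (card L) \<le> u" "a \<bullet> indicator_point e S L > c"
      and K: "a \<bullet> indicator_point e S K = c"
    for a c K L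
  proof -
    have "ineq_lhs S' (indicator_point e S K) = ineq_rhs e S l S' p (indicator_point e S K)"
    proof (rule facet_tight_where_dominated_tight[OF facet linear_ineq_lhs linear_ineq_rhs])
      show "indicator_point e S L \<in> Xlu e S l u" "indicator_point e S K \<in> Xlu e S l u"
        using L size by (auto simp: Xlu_eq_image[OF enum])
    qed (use nonneg dominated L K in
        \<open>auto simp: Xlu_eq_image[OF enum] ineq_lhs_indicator_point\<close>)
    then show ?thesis
      using rhs_meets[OF meets] by (simp add: ineq_lhs_indicator_point)
  qed
  have L1: "S' \<inter> S p = {}"
  proof (rule ccontr)
    assume "S' \<inter> S p \<noteq> {}"
    then obtain j where j: "j \<in> S'" "j \<in> S p" by auto
    define a :: "(real^'n) \<times> (real^'m)" where "a = (axis j 1, 0)"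
    have a: "a \<bullet> indicator_point e S K = of_bool (j \<in> K)" for K
      by (simp add: a_def indicator_point_def inner_axis')
    have "\<not> S p \<subseteq> {j}" using Sp_ge card_mono[of "{j}" "S p"] by auto
    then obtain i where i: "i \<in> S p" "i \<noteq> j" by auto
    \<comment> \<open>\<open>max l 2\<close> is between \<open>l\<close> and \<open>u\<close>, makes room for \<open>s\<close> and \<open>i\<close>, and is at most \<open>n - 1\<close>.\<close>
    obtain K where K: "{s, i} \<subseteq> K" "K \<subseteq> - {j}" "card K = nat (max l 2)"
    proof -
      have "card {s, i} \<le> nat (max l 2)" "nat (max l 2) \<le> card (- {j})"
        using n s i by (auto simp: Compl_eq_Diff_UNIV card_insert_if)
      moreover have "{s, i} \<subseteq> - {j}" using s i j by auto
      ultimately show thesis using that exists_subset_between by (metis finite)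
    qed
    obtain L where L: "{j} \<subseteq> L" "card L = nat (max l 2)"
    proof -
      have "card {j} \<le> nat (max l 2)" "nat (max l 2) \<le> card (UNIV :: 'n set)"
        using n by auto
      then show thesis using that exists_subset_between by (metis finite subset_UNIV)
    qed
    have "K \<inter> S' = {}"
    proof (rule tight[where a = a and c = 0 and L = L])
      fix M :: "'n set"
      assume M: "l \<le> int (card M)"
      show "a \<bullet> indicator_point e S M - 0 \<le>
        real (card (M \<inter> S')) - ineq_rhs e S l S' p (indicator_point e S M)"
      proof (cases "M \<inter> S p = {}")
        case True
        with j have "j \<notin> M" by auto
        then show ?thesis using rhs_le[OF True, of l S'] M by (simp add: a)
      next
        case False
        have "0 < card (M \<inter> S')" if "j \<in> M" using that j by (auto simp: card_gt_0_iff)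
        then show ?thesis using rhs_meets[OF False] by (auto simp: a Suc_le_eq)
      qed
    qed (use K L i lu in \<open>auto simp: a\<close>)
    with K s show False by auto
  qed
  moreover have "int (card S') \<le> int CARD('n) - l - 1"
  proof (rule ccontr)
    assume "\<not> int (card S') \<le> int CARD('n) - l - 1"
    then have S'_ge: "int CARD('n) \<le> int (card S') + l" by simp
    define a :: "(real^'n) \<times> (real^'m)" where "a = (1, 0)"
    have a: "a \<bullet> indicator_point e S K = card K" for K
      by (simp add: a_def indicator_point_def inner_vec_def sum.If_cases)
    \<comment> \<open>\<open>S p\<close> fits into the complement of \<open>S'\<close>, so there is room for an element of each in \<open>K\<close>.\<close>
    have "card S' + card (S p) \<le> CARD('n)"
      using L1 by (subst card_Un_disjoint[symmetric]) (auto intro: card_mono)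
    with Sp_ge S'_ge have l: "2 \<le> l" by linarith
    obtain i where i: "i \<in> S p" using Sp_ge by fastforce
    obtain K where K: "{s, i} \<subseteq> K" "card K = nat l"
    proof -
      have "card {s, i} \<le> nat l" "nat l \<le> card (UNIV :: 'n set)"
        using n l by (auto simp: card_insert_if)
      then show thesis using that exists_subset_between by (metis finite subset_UNIV)
    qed
    obtain L :: "'n set" where L: "card L = nat (l + 1)"
    proof -
      have "nat (l + 1) \<le> card (UNIV :: 'n set)" using n by auto
      then show thesis using that obtain_subset_with_card_n by metis
    qed
    have "K \<inter> S' = {}"
    proof (rule tight[where a = a and c = "of_int l" and L = L])
      fix M :: "'n set"
      show "a \<bullet> indicator_point e S M - of_int l \<le>
        real (card (M \<inter> S')) - ineq_rhs e S l S' p (indicator_point e S M)"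
      proof (cases "M \<inter> S p = {}")
        case True
        then show ?thesis using rhs_le[OF True, of l S'] by (simp add: a)
      next
        case False
        have "card (M - S') + card S' \<le> CARD('n)"
          by (subst card_Un_disjoint[symmetric]) (auto intro: card_mono)
        moreover have "card M = card (M \<inter> S') + card (M - S')"
          by (metis card_Int_Diff finite)
        ultimately show ?thesis using rhs_meets[OF False, of l S'] S'_ge by (simp add: a)
      qed
    qed (use K L i l lu in \<open>auto simp: a\<close>)
    with K s show False by auto
  qed
  ultimately show ?thesis by simp
qed

end
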